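(* Let $A$ be a finite-dimensional unital algebra over an algebraically closed field $K$ with $\Lambda_0\neq\emptyset$, and let $B=\operatorname{End}_A\bigl(\bigoplus_{\lambda\in\Lambda_0}P^\lambda\bigr)$. Assume that the map $'$ is an involution on $\Lambda_0$. If there exists a symmetrizing form $\tau$ on $B$, then (i) $\lambda'=\lambda$ and $\tau(\theta_\lambda)\neq 0$ for all $\lambda\in\Lambda_0$; (ii) $\tau(f)=0$ for all $f\in\operatorname{Hom}_A(P^\lambda,P^\mu)$ with $\lambda\neq\mu$ in $\Lambda_0$.
   Context: $A\text{-mod}$ is the category of finite-dimensional $A$-modules; $\{L^\lambda\mid\lambda\in\Lambda\}$ is a complete set of pairwise non-isomorphic simple $A$-modules ($\Lambda$ finite); $P^\lambda$ and $I^\lambda$ are the projective cover and injective envelope of $L^\lambda$. $\Lambda_0:=\{\lambda\in\Lambda\mid P^\lambda\text{ is injective}\}$. For $\lambda\in\Lambda_0$ let $\lambda'\in\Lambda$ be the unique element with $P^\lambda\cong I^{\lambda'}$, equivalently $\operatorname{soc}(P^\lambda)\cong L^{\lambda'}$. "The map $'$ is an involution on $\Lambda_0$" means $\lambda'\in\Lambda_0$ and $(\lambda')'=\lambda$ for all $\lambda\in\Lambda_0$. We regard $B=\bigoplus_{\lambda,\mu\in\Lambda_0}\operatorname{Hom}_A(P^\lambda,P^\mu)$. For each $\lambda\in\Lambda_0$, $\theta_\lambda\in\operatorname{Hom}_A(P^\lambda,P^{\lambda'})$ is a fixed nonzero homomorphism (unique up to scalar) with $\operatorname{Im}(\theta_\lambda)=\operatorname{soc}(P^{\lambda'})$.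 A symmetrizing form on $B$ is a $K$-linear map $\tau:B\to K$ such that the bilinear form $(f,g)_\tau:=\tau(fg)$ is symmetric and non-degenerate. *)

theory Defs
  imports "HOL-Computational_Algebra.Polynomial" "HOL-Library.Function_Algebras"
begin

section \<open>Finite-dimensional algebras and modules\<close>

locale fd_algebra = vector_space scale
  for scale :: "'k::alg_closed_field \<Rightarrow> 'a::ring_1 \<Rightarrow> 'a" +
  assumes scale_mult_left: "scale c a * b = scale c (a * b)"
    and scale_mult_right: "a * scale c b = scale c (a * b)"
    and finite_dim: "\<exists>S. finite S \<and> span S = UNIV"

text \<open>
  A left module is carried by a subset of an abelian group type. Its vector space structure over
  the ground field is \<open>c \<bullet> x = (scale c 1) x\<close>, so it need not be recorded separately.
\<close>

record ('a, 'm) lmod =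
  carr :: "'m set"
  act :: "'a \<Rightarrow> 'm \<Rightarrow> 'm"

definition lmodule :: "('a::ring_1, 'm::ab_group_add) lmod \<Rightarrow> bool" where
  "lmodule M \<longleftrightarrow>
     0 \<in> carr M \<and>
     (\<forall>x\<in>carr M. \<forall>y\<in>carr M. x + y \<in> carr M) \<and>
     (\<forall>x\<in>carr M. - x \<in> carr M) \<and>
     (\<forall>a. \<forall>x\<in>carr M. act M a x \<in> carr M) \<and>
     (\<forall>a. \<forall>x\<in>carr M. \<forall>y\<in>carr M. act M a (x + y) = act M a x + act M a y) \<and>
     (\<forall>a b. \<forall>x\<in>carr M. act M (a + b) x = act M a x + act M b x) \<and>
     (\<forall>a b. \<forall>x\<in>carr M. act M (a * b) x = act M a (act M b x)) \<and>
     (\<forall>x\<in>carr M. act M 1 x = x)"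

definition fdmodule ::
  "('k \<Rightarrow> 'a::ring_1 \<Rightarrow> 'a) \<Rightarrow> ('a, 'm::ab_group_add) lmod \<Rightarrow> bool" where
  "fdmodule scale M \<longleftrightarrow> lmodule M \<and>
     (\<exists>S. finite S \<and> S \<subseteq> carr M \<and>
        (\<forall>x\<in>carr M. \<exists>c. x = (\<Sum>s\<in>S. act M (scale (c s) 1) s)))"

definition submodule :: "'m::ab_group_add set \<Rightarrow> ('a::ring_1, 'm) lmod \<Rightarrow> bool" where
  "submodule N M \<longleftrightarrow> N \<subseteq> carr M \<and> 0 \<in> N \<and>
     (\<forall>x\<in>N. \<forall>y\<in>N. x + y \<in> N) \<and> (\<forall>a. \<forall>x\<in>N. act M a x \<in> N)"

text \<open>
  Homomorphisms are set to \<open>0\<close> outside the domain module. Equality of functions is then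
  equality of homomorphisms, and pointwise addition and composition stay within this convention.
\<close>

definition Hom ::
  "('a::ring_1, 'm::ab_group_add) lmod \<Rightarrow> ('a, 'n::ab_group_add) lmod \<Rightarrow> ('m \<Rightarrow> 'n) set" where
  "Hom M N = {f. (\<forall>x\<in>carr M. f x \<in> carr N) \<and>
     (\<forall>x\<in>carr M. \<forall>y\<in>carr M. f (x + y) = f x + f y) \<and>
     (\<forall>a. \<forall>x\<in>carr M. f (act M a x) = act N a (f x)) \<and>
     (\<forall>x. x \<notin> carr M \<longrightarrow> f x = 0)}"

definition iso_mod ::
  "('a::ring_1, 'm::ab_group_add) lmod \<Rightarrow> ('a, 'n::ab_group_add) lmod \<Rightarrow> bool" where
  "iso_mod M N \<longleftrightarrow> (\<exists>f\<in>Hom M N. bij_betw f (carr M) (carr N))"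

definition simple_mod :: "('a::ring_1, 'm::ab_group_add) lmod \<Rightarrow> bool" where
  "simple_mod M \<longleftrightarrow> lmodule M \<and> carr M \<noteq> {0} \<and>
     (\<forall>N. submodule N M \<longrightarrow> N = {0} \<or> N = carr M)"

definition simple_submodules :: "('a::ring_1, 'm::ab_group_add) lmod \<Rightarrow> 'm set set" where
  "simple_submodules M = {S. submodule S M \<and> simple_mod (M\<lparr>carr := S\<rparr>)}"

text \<open>The socle is the (not necessarily direct) sum of all simple submodules.\<close>

definition soc :: "('a::ring_1, 'm::ab_group_add) lmod \<Rightarrow> 'm set" where
  "soc M = {\<Sum>S\<in>F. g S | F g. finite F \<and> F \<subseteq> simple_submodules M \<and> (\<forall>S\<in>F. g S \<in> S)}"


section \<open>The category of finite-dimensional modules\<close>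

text \<open>
  A formula of HOL cannot quantify over types, so a quantifier over all finite-dimensional modules
  is rendered as a quantifier over those carried by a subset of the type
  \<open>nat \<Rightarrow> 'k\<close>. Nothing is lost: by the lemma \<open>fdmodule_copy\<close>, every
  finite-dimensional module, on any type, is isomorphic to one of these.
\<close>

lemma fdmodule_copy:
  fixes scale :: "'k::alg_closed_field \<Rightarrow> 'a::ring_1 \<Rightarrow> 'a"
    and M :: "('a, 'm::ab_group_add) lmod"
  assumes alg: "fd_algebra scale" and fd: "fdmodule scale M"
  shows "\<exists>U :: ('a, nat \<Rightarrow> 'k) lmod. fdmodule scale U \<and> iso_mod M U"
proof -
  interpret fd_algebra scale by (rule alg)
  define k where "k c x = act M (scale c 1) x" for c x
  have lm: "lmodule M" using fd by (simp add: fdmodule_def)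
  have M0: "0 \<in> carr M" and Madd: "\<And>x y. x \<in> carr M \<Longrightarrow> y \<in> carr M \<Longrightarrow> x + y \<in> carr M"
    and Mact: "\<And>a x. x \<in> carr M \<Longrightarrow> act M a x \<in> carr M"
    and Mneg: "\<And>x. x \<in> carr M \<Longrightarrow> - x \<in> carr M"
    and act_add: "\<And>a x y. x \<in> carr M \<Longrightarrow> y \<in> carr M \<Longrightarrow> act M a (x + y) = act M a x + act M a y"
    and add_act: "\<And>a b x. x \<in> carr M \<Longrightarrow> act M (a + b) x = act M a x + act M b x"
    and act_mult: "\<And>a b x. x \<in> carr M \<Longrightarrow> act M (a * b) x = act M a (act M b x)"
    and act_one: "\<And>x. x \<in> carr M \<Longrightarrow> act M 1 x = x"
    using lm by (simp_all add: lmodule_def)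
  have act_0: "act M a 0 = 0" for a using act_add[OF M0 M0, of a] by simp
  have kM: "x \<in> carr M \<Longrightarrow> k c x \<in> carr M" for c x by (simp add: k_def Mact)
  have k_add: "x \<in> carr M \<Longrightarrow> k (c + d) x = k c x + k d x" for c d x
    by (simp add: k_def scale_left_distrib add_act)
  have k_mult: "x \<in> carr M \<Longrightarrow> k (c * d) x = k c (k d x)" for c d x
    by (simp add: k_def act_mult[symmetric] scale_mult_left)
  have k_zero: "x \<in> carr M \<Longrightarrow> k 0 x = 0" for x using k_add[of x 0 0] by simp
  have k_one: "x \<in> carr M \<Longrightarrow> k 1 x = x" for x by (simp add: k_def act_one)
  have k_act: "x \<in> carr M \<Longrightarrow> act M a (k c x) = k c (act M a x)" for a c x
    by (simp add: k_def act_mult[symmetric] scale_mult_left scale_mult_right)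
  have sumM: "(\<And>i. i \<in> J \<Longrightarrow> g i \<in> carr M) \<Longrightarrow> sum g J \<in> carr M" for g :: "'i \<Rightarrow> 'm" and J
    by (induction J rule: infinite_finite_induct) (auto simp: M0 Madd)
  have act_sum: "(\<And>i. i \<in> J \<Longrightarrow> g i \<in> carr M) \<Longrightarrow> act M a (sum g J) = (\<Sum>i\<in>J. act M a (g i))"
    for g :: "'i \<Rightarrow> 'm" and J a
    by (induction J rule: infinite_finite_induct) (auto simp: act_0 act_add sumM)
  define spans where "spans S \<longleftrightarrow> finite S \<and> S \<subseteq> carr M \<and>
    (\<forall>x\<in>carr M. \<exists>c. x = (\<Sum>s\<in>S. k (c s) s))" for S
  have "\<exists>S. spans S" using fd by (auto simp: fdmodule_def spans_def k_def)
  then obtain S where S: "spans S" and Smin: "\<And>T. spans T \<Longrightarrow> card S \<le> card T"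
    using ex_has_least_nat[of spans _ card] by blast
  have finS: "finite S" and SM: "S \<subseteq> carr M" using S by (auto simp: spans_def)
  define n where "n = card S"
  obtain e where e: "bij_betw e {..<n} S"
    using ex_bij_betw_nat_finite[OF finS] by (auto simp: n_def atLeast0LessThan)
  have eM: "i < n \<Longrightarrow> e i \<in> carr M" for i using e SM by (auto simp: bij_betw_def)
  define V where "V = {v :: nat \<Rightarrow> 'k. \<forall>i\<ge>n. v i = 0}"
  define \<phi> where "\<phi> v = (\<Sum>i<n. k (v i) (e i))" for v :: "nat \<Rightarrow> 'k"
  have \<phi>M: "\<phi> v \<in> carr M" for v unfolding \<phi>_def by (rule sumM) (simp add: kM eM)
  have \<phi>_add: "\<phi> (u + v) = \<phi> u + \<phi> v" for u v
    by (simp add: \<phi>_def k_add eM sum.distrib)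
  have \<phi>_k: "\<phi> (\<lambda>i. t * v i) = k t (\<phi> v)" for t v
    unfolding \<phi>_def k_def[of t] by (subst act_sum) (simp_all add: kM eM k_mult flip: k_def)
  have \<phi>_surj: "\<exists>v\<in>V. \<phi> v = x" if x: "x \<in> carr M" for x
  proof -
    obtain c where c: "x = (\<Sum>s\<in>S. k (c s) s)" using S x by (auto simp: spans_def)
    have "\<phi> (\<lambda>i. if i < n then c (e i) else 0) = (\<Sum>i<n. k (c (e i)) (e i))" by (simp add: \<phi>_def)
    also have "\<dots> = x" unfolding c by (rule sum.reindex_bij_betw[OF e])
    finally show ?thesis
      by (intro bexI[of _ "\<lambda>i. if i < n then c (e i) else 0"]) (auto simp: V_def)
  qed
  have ker: "w i = 0" if w: "\<phi> w = 0" and i: "i < n" for w i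
  proof (rule ccontr)
    assume wi: "w i \<noteq> 0"
    have "spans (S - {e i})"
      unfolding spans_def
    proof (intro conjI ballI)
      fix x assume x: "x \<in> carr M"
      obtain u where u: "\<phi> u = x" using \<phi>_surj[OF x] by blast
      define t where "t = - (u i / w i)"
      define v where "v = u + (\<lambda>j. t * w j)"
      have vx: "\<phi> v = x" by (simp add: v_def \<phi>_add \<phi>_k w u) (simp add: k_def act_0)
      have vi: "v i = 0" using wi by (simp add: v_def t_def)
      define c where "c s = v (the_inv_into {..<n} e s)" for s
      have ce: "c (e j) = v j" if "j < n" for j
        using that e by (simp add: c_def bij_betw_def the_inv_into_f_f)
      have "\<phi> v = (\<Sum>j<n. k (c (e j)) (e j))" by (simp add: \<phi>_def ce)
      also have "\<dots> = (\<Sum>s\<in>S. k (c s) s)" by (rule sum.reindex_bij_betw[OF e])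
      also have "\<dots> = (\<Sum>s\<in>S - {e i}. k (c s) s)"
        using finS ce[OF i] vi eM[OF i] by (intro sum.mono_neutral_right) (auto simp: k_zero)
      finally show "\<exists>c. x = (\<Sum>s\<in>S - {e i}. k (c s) s)" unfolding vx by (rule exI[of _ c])
    qed (use finS SM in auto)
    moreover have "card (S - {e i}) < card S"
      using e i finS by (intro psubset_card_mono) (auto simp: bij_betw_def)
    ultimately show False using Smin[of "S - {e i}"] by simp
  qed
  have inj: "inj_on \<phi> V"
  proof (rule inj_onI)
    fix u v assume u: "u \<in> V" and v: "v \<in> V" and eq: "\<phi> u = \<phi> v"
    have "\<phi> ((u - v) + v) = \<phi> (u - v) + \<phi> v" by (rule \<phi>_add)
    then have "\<phi> (u - v) = 0" using eq by simp
    then have *: "u i = v i" if "i < n" for i using ker[of "u - v" i] that by simp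
    show "u = v"
    proof
      fix i show "u i = v i" using * u v by (cases "i < n") (simp_all add: V_def)
    qed
  qed
  define \<psi> where "\<psi> = the_inv_into V \<phi>"
  have \<psi>\<phi>: "v \<in> V \<Longrightarrow> \<psi> (\<phi> v) = v" for v by (simp add: \<psi>_def the_inv_into_f_f inj)
  have \<phi>\<psi>: "\<phi> (\<psi> x) = x" and \<psi>V: "\<psi> x \<in> V" if "x \<in> carr M" for x
    using \<phi>_surj[OF that] \<psi>\<phi> by auto
  have V0: "0 \<in> V" and Vadd: "\<And>u v. u \<in> V \<Longrightarrow> v \<in> V \<Longrightarrow> u + v \<in> V"
    and Vneg: "\<And>u. u \<in> V \<Longrightarrow> - u \<in> V"
    by (simp_all add: V_def)
  have \<psi>_add: "\<psi> (x + y) = \<psi> x + \<psi> y" if "x \<in> carr M" "y \<in> carr M" for x y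
    using \<psi>\<phi>[OF Vadd[OF \<psi>V \<psi>V, OF that]] by (simp add: \<phi>_add \<phi>\<psi> that)
  have \<psi>_0: "\<psi> 0 = 0" using \<psi>_add[OF M0 M0] by simp
  have \<psi>_sum: "(\<And>i. i \<in> J \<Longrightarrow> g i \<in> carr M) \<Longrightarrow> \<psi> (sum g J) = (\<Sum>i\<in>J. \<psi> (g i))"
    for g :: "'m \<Rightarrow> 'm" and J
    by (induction J rule: infinite_finite_induct) (auto simp: \<psi>_0 \<psi>_add sumM)
  define U where "U = \<lparr>carr = V, act = (\<lambda>a v. \<psi> (act M a (\<phi> v)))\<rparr>"
  have U_simps: "carr U = V" "\<And>a v. act U a v = \<psi> (act M a (\<phi> v))" by (simp_all add: U_def)
  have lmU: "lmodule U"
    by (auto simp: lmodule_def U_simps V0 Vadd Vneg \<psi>V Mact \<phi>M \<phi>_add act_add \<psi>_add add_act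
        act_mult \<phi>\<psi> act_one \<psi>\<phi>)
  have injS: "inj_on \<psi> S" by (rule inj_on_inverseI[of _ \<phi>]) (use SM \<phi>\<psi> in auto)
  have "\<exists>c. v = (\<Sum>s\<in>\<psi> ` S. act U (scale (c s) 1) s)" if v: "v \<in> V" for v
  proof -
    obtain c where c: "\<phi> v = (\<Sum>s\<in>S. k (c s) s)" using S \<phi>M[of v] unfolding spans_def by blast
    have "v = \<psi> (\<phi> v)" by (simp add: \<psi>\<phi> v)
    also have "\<dots> = (\<Sum>s\<in>S. \<psi> (k (c s) s))" unfolding c using SM by (intro \<psi>_sum) (auto simp: kM)
    also have "\<dots> = (\<Sum>s\<in>S. act U (scale (c (\<phi> (\<psi> s))) 1) (\<psi> s))"
      using SM by (intro sum.cong) (auto simp: U_simps \<phi>\<psi> k_def subset_iff)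
    also have "\<dots> = (\<Sum>s\<in>\<psi> ` S. act U (scale (c (\<phi> s)) 1) s)"
      by (simp add: sum.reindex[OF injS])
    finally show ?thesis by (rule exI[of _ "\<lambda>s. c (\<phi> s)"])
  qed
  then have "fdmodule scale U"
    unfolding fdmodule_def using lmU finS SM \<psi>V
    by (intro conjI exI[of _ "\<psi> ` S"]) (auto simp: U_simps(1) subset_iff)
  moreover have "iso_mod M U"
    unfolding iso_mod_def
  proof
    show "(\<lambda>x. if x \<in> carr M then \<psi> x else 0) \<in> Hom M U"
      by (auto simp: Hom_def U_simps \<psi>V \<psi>_add Mact Madd \<phi>\<psi>)
    show "bij_betw (\<lambda>x. if x \<in> carr M then \<psi> x else 0) (carr M) (carr U)"
      by (rule bij_betw_byWitness[where f' = \<phi>]) (auto simp: \<phi>\<psi> \<psi>\<phi> \<psi>V \<phi>M U_simps)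
  qed
  ultimately show ?thesis by blast
qed

definition projective_mod ::
  "('k::alg_closed_field \<Rightarrow> 'a::ring_1 \<Rightarrow> 'a) \<Rightarrow> ('a, 'm::ab_group_add) lmod \<Rightarrow> bool" where
  "projective_mod scale P \<longleftrightarrow> fdmodule scale P \<and>
     (\<forall>(X :: ('a, nat \<Rightarrow> 'k) lmod) (Y :: ('a, nat \<Rightarrow> 'k) lmod).
        fdmodule scale X \<and> fdmodule scale Y \<longrightarrow>
        (\<forall>p\<in>Hom X Y. p ` carr X = carr Y \<longrightarrow>
           (\<forall>f\<in>Hom P Y. \<exists>h\<in>Hom P X. p \<circ> h = f)))"

definition injective_mod ::
  "('k::alg_closed_field \<Rightarrow> 'a::ring_1 \<Rightarrow> 'a) \<Rightarrow> ('a, 'm::ab_group_add) lmod \<Rightarrow> bool" where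
  "injective_mod scale I \<longleftrightarrow> fdmodule scale I \<and>
     (\<forall>(X :: ('a, nat \<Rightarrow> 'k) lmod) (Y :: ('a, nat \<Rightarrow> 'k) lmod).
        fdmodule scale X \<and> fdmodule scale Y \<longrightarrow>
        (\<forall>i\<in>Hom X Y. inj_on i (carr X) \<longrightarrow>
           (\<forall>f\<in>Hom X I. \<exists>h\<in>Hom Y I. h \<circ> i = f)))"

definition superfluous :: "'m::ab_group_add set \<Rightarrow> ('a::ring_1, 'm) lmod \<Rightarrow> bool" where
  "superfluous U M \<longleftrightarrow> submodule U M \<and>
     (\<forall>N. submodule N M \<and> {u + n | u n. u \<in> U \<and> n \<in> N} = carr M \<longrightarrow> N = carr M)"

definition essential :: "'m::ab_group_add set \<Rightarrow> ('a::ring_1, 'm) lmod \<Rightarrow> bool" where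
  "essential U M \<longleftrightarrow> submodule U M \<and>
     (\<forall>N. submodule N M \<and> U \<inter> N = {0} \<longrightarrow> N = {0})"

definition projective_cover ::
  "('k::alg_closed_field \<Rightarrow> 'a::ring_1 \<Rightarrow> 'a) \<Rightarrow>
   ('a, 'm::ab_group_add) lmod \<Rightarrow> ('a, 'n::ab_group_add) lmod \<Rightarrow> bool" where
  "projective_cover scale P L \<longleftrightarrow> projective_mod scale P \<and>
     (\<exists>p\<in>Hom P L. p ` carr P = carr L \<and> superfluous {x \<in> carr P. p x = 0} P)"

definition injective_envelope ::
  "('k::alg_closed_field \<Rightarrow> 'a::ring_1 \<Rightarrow> 'a) \<Rightarrow>
   ('a, 'm::ab_group_add) lmod \<Rightarrow> ('a, 'n::ab_group_add) lmod \<Rightarrow> bool" where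
  "injective_envelope scale I L \<longleftrightarrow> injective_mod scale I \<and>
     (\<exists>i\<in>Hom L I. inj_on i (carr L) \<and> essential (i ` carr L) I)"

definition complete_simples ::
  "('k::alg_closed_field \<Rightarrow> 'a::ring_1 \<Rightarrow> 'a) \<Rightarrow> 'l set \<Rightarrow>
   ('l \<Rightarrow> ('a, 'm::ab_group_add) lmod) \<Rightarrow> bool" where
  "complete_simples scale \<Lambda> L \<longleftrightarrow>
     (\<forall>l\<in>\<Lambda>. fdmodule scale (L l) \<and> simple_mod (L l)) \<and>
     (\<forall>l\<in>\<Lambda>. \<forall>m\<in>\<Lambda>. iso_mod (L l) (L m) \<longrightarrow> l = m) \<and>
     (\<forall>S :: ('a, nat \<Rightarrow> 'k) lmod.
        fdmodule scale S \<and> simple_mod S \<longrightarrow> (\<exists>l\<in>\<Lambda>. iso_mod S (L l)))"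


section \<open>The index set, the map on it, and the endomorphism algebra\<close>

definition Lambda0 ::
  "('k::alg_closed_field \<Rightarrow> 'a::ring_1 \<Rightarrow> 'a) \<Rightarrow> 'l set \<Rightarrow>
   ('l \<Rightarrow> ('a, 'm::ab_group_add) lmod) \<Rightarrow> 'l set" where
  "Lambda0 scale \<Lambda> P = {l \<in> \<Lambda>. injective_mod scale (P l)}"

definition prime_idx ::
  "'l set \<Rightarrow> ('l \<Rightarrow> ('a::ring_1, 'm::ab_group_add) lmod) \<Rightarrow>
   ('l \<Rightarrow> ('a, 'm) lmod) \<Rightarrow> 'l \<Rightarrow> 'l" where
  "prime_idx \<Lambda> P I l = (THE m. m \<in> \<Lambda> \<and> iso_mod (P l) (I m))"

text \<open>Families indexed by \<open>J\<close> are set to \<open>0\<close> outside \<open>J\<close>; the sum is used for finite \<open>J\<close> only.\<close>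

definition dsum ::
  "'l set \<Rightarrow> ('l \<Rightarrow> ('a::ring_1, 'm::ab_group_add) lmod) \<Rightarrow> ('a, 'l \<Rightarrow> 'm) lmod" where
  "dsum J M = \<lparr> carr = {x. (\<forall>l\<in>J. x l \<in> carr (M l)) \<and> (\<forall>l. l \<notin> J \<longrightarrow> x l = 0)},
                act = (\<lambda>a x l. if l \<in> J then act (M l) a (x l) else 0) \<rparr>"

text \<open>
  The identification of \<open>Hom (M l) (M m)\<close> with a summand of the endomorphism algebra of the
  direct sum: project to the component \<open>l\<close>, apply \<open>f\<close>, include as the component \<open>m\<close>.
\<close>

definition block ::
  "'l set \<Rightarrow> ('l \<Rightarrow> ('a::ring_1, 'm::ab_group_add) lmod) \<Rightarrow> 'l \<Rightarrow> 'l \<Rightarrow>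
   ('m \<Rightarrow> 'm) \<Rightarrow> ('l \<Rightarrow> 'm) \<Rightarrow> ('l \<Rightarrow> 'm)" where
  "block J M l m f = (\<lambda>x. if x \<in> carr (dsum J M) then (\<lambda>n. if n = m then f (x l) else 0) else 0)"

text \<open>
  The algebra is \<open>Hom M M\<close> with pointwise addition, composition as
  multiplication and scalar multiplication \<open>(c \<bullet> f) x = (scale c 1) (f x)\<close>.
\<close>

definition symmetrizing_form ::
  "('k::field \<Rightarrow> 'a::ring_1 \<Rightarrow> 'a) \<Rightarrow> ('a, 'm::ab_group_add) lmod \<Rightarrow> (('m \<Rightarrow> 'm) \<Rightarrow> 'k) \<Rightarrow> bool"
  where
  "symmetrizing_form scale M \<tau> \<longleftrightarrow>
     (\<forall>f\<in>Hom M M. \<forall>g\<in>Hom M M. \<tau> (f + g) = \<tau> f + \<tau> g) \<and>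
     (\<forall>c. \<forall>f\<in>Hom M M. \<tau> (\<lambda>x. act M (scale c 1) (f x)) = c * \<tau> f) \<and>
     (\<forall>f\<in>Hom M M. \<forall>g\<in>Hom M M. \<tau> (f \<circ> g) = \<tau> (g \<circ> f)) \<and>
     (\<forall>f\<in>Hom M M. (\<forall>g\<in>Hom M M. \<tau> (f \<circ> g) = 0) \<longrightarrow> f = 0) \<and>
     (\<forall>g\<in>Hom M M. (\<forall>f\<in>Hom M M. \<tau> (f \<circ> g) = 0) \<longrightarrow> g = 0)"

end

theory Submission
  imports Defs
begin

text \<open>
  Let \<open>p\<close> be the projection of \<open>P\<^sup>\<lambda>\<close> onto its simple top. Every proper submodule of \<open>P\<^sup>\<lambda>\<close> lies in
  \<open>ker p\<close>, and \<open>\<theta>\<^sub>\<lambda>\<close> vanishes on \<open>ker p\<close> because its image is semisimple. Non-degeneracy yields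
  \<open>b : P\<^sup>\<lambda>\<^sup>' \<rightarrow> P\<^sup>\<lambda>\<close> with \<open>\<tau>(\<theta>\<^sub>\<lambda> b) \<noteq> 0\<close>. In particular \<open>\<theta>\<^sub>\<lambda> b \<noteq> 0\<close>, so \<open>b\<close> is surjective; hence the tops
  of the two modules agree and \<open>\<lambda>' = \<lambda>\<close>. Over an algebraically closed field \<open>b - c\<close> is not surjective
  for some scalar \<open>c\<close>, so \<open>\<theta>\<^sub>\<lambda> b = c \<theta>\<^sub>\<lambda>\<close> and \<open>\<tau>(\<theta>\<^sub>\<lambda>) \<noteq> 0\<close>. Off-diagonal maps satisfy \<open>f = e\<^sub>\<mu> f\<close> and
  \<open>f e\<^sub>\<mu> = 0\<close>, so \<open>\<tau>(f) = 0\<close> by symmetry.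
\<close>

section \<open>Submodules and homomorphisms\<close>

lemma lmoduleD:
  assumes "lmodule M"
  shows "0 \<in> carr M"
    and "x \<in> carr M \<Longrightarrow> y \<in> carr M \<Longrightarrow> x + y \<in> carr M"
    and "x \<in> carr M \<Longrightarrow> - x \<in> carr M"
    and "x \<in> carr M \<Longrightarrow> act M a x \<in> carr M"
    and "x \<in> carr M \<Longrightarrow> y \<in> carr M \<Longrightarrow> act M a (x + y) = act M a x + act M a y"
    and "x \<in> carr M \<Longrightarrow> act M (a + b) x = act M a x + act M b x"
    and "x \<in> carr M \<Longrightarrow> act M (a * b) x = act M a (act M b x)"
    and "x \<in> carr M \<Longrightarrow> act M 1 x = x"
  using assms by (simp_all add: lmodule_def)

lemma HomD:
  assumes "f \<in> Hom M N"
  shows "x \<in> carr M \<Longrightarrow> f x \<in> carr N"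
    and "x \<in> carr M \<Longrightarrow> y \<in> carr M \<Longrightarrow> f (x + y) = f x + f y"
    and "x \<in> carr M \<Longrightarrow> f (act M a x) = act N a (f x)"
    and "x \<notin> carr M \<Longrightarrow> f x = 0"
  using assms by (simp_all add: Hom_def)

lemma submoduleD:
  assumes "submodule N M"
  shows "x \<in> N \<Longrightarrow> x \<in> carr M"
    and "0 \<in> N"
    and "x \<in> N \<Longrightarrow> y \<in> N \<Longrightarrow> x + y \<in> N"
    and "x \<in> N \<Longrightarrow> act M a x \<in> N"
  using assms by (auto simp: submodule_def)

lemma act_zero_right:
  assumes "lmodule M"
  shows "act M a 0 = 0"
  using lmoduleD(5)[OF assms lmoduleD(1)[OF assms] lmoduleD(1)[OF assms], of a] by simp

lemma act_zero_left:
  assumes "lmodule M" "x \<in> carr M"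
  shows "act M 0 x = 0"
  using lmoduleD(6)[OF assms, of 0 0] by simp

lemma act_minus_left:
  assumes "lmodule M" "x \<in> carr M"
  shows "act M (- a) x = - act M a x"
  using lmoduleD(6)[OF assms, of a "- a"] act_zero_left[OF assms]
  by (simp add: eq_neg_iff_add_eq_0 add.commute)

lemma lmodule_diff:
  assumes "lmodule M" "x \<in> carr M" "y \<in> carr M"
  shows "x - y \<in> carr M"
  using lmoduleD(2)[OF assms(1,2) lmoduleD(3)[OF assms(1,3)]] by simp

lemma lmodule_sum:
  assumes "lmodule M" "\<And>i. i \<in> J \<Longrightarrow> g i \<in> carr M"
  shows "sum g J \<in> carr M"
  using assms(2)
  by (induction J rule: infinite_finite_induct) (auto simp: lmoduleD[OF assms(1)])

lemma act_sum_left: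
  assumes "lmodule M" "x \<in> carr M"
  shows "act M (sum g J) x = (\<Sum>i\<in>J. act M (g i) x)"
  by (induction J rule: infinite_finite_induct) (auto simp: lmoduleD[OF assms(1)] act_zero_left assms)

lemma act_sum_right:
  assumes "lmodule M" "\<And>i. i \<in> J \<Longrightarrow> g i \<in> carr M"
  shows "act M a (sum g J) = (\<Sum>i\<in>J. act M a (g i))"
  using assms(2)
  by (induction J rule: infinite_finite_induct)
    (auto simp: lmoduleD[OF assms(1)] act_zero_right lmodule_sum assms(1))

lemma Hom_zero:
  assumes "lmodule M" "f \<in> Hom M N"
  shows "f 0 = 0"
  using HomD(2)[OF assms(2) lmoduleD(1)[OF assms(1)] lmoduleD(1)[OF assms(1)]] by simp

lemma Hom_diff:
  assumes "lmodule M" "f \<in> Hom M N" "x \<in> carr M" "y \<in> carr M"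
  shows "f (x - y) = f x - f y"
  using HomD(2)[OF assms(2) lmodule_diff[OF assms(1,3,4)] assms(4)] by (simp add: eq_diff_eq)

lemma Hom_sum:
  assumes "lmodule M" "f \<in> Hom M N" "\<And>i. i \<in> J \<Longrightarrow> g i \<in> carr M"
  shows "f (sum g J) = (\<Sum>i\<in>J. f (g i))"
  using assms(3)
  by (induction J rule: infinite_finite_induct)
    (auto simp: Hom_zero[OF assms(1,2)] HomD(2)[OF assms(2)] lmodule_sum assms(1))

lemma Hom_comp:
  assumes "lmodule N" "f \<in> Hom M N" "g \<in> Hom N Q"
  shows "g \<circ> f \<in> Hom M Q"
  using HomD[OF assms(2)] HomD[OF assms(3)] Hom_zero[OF assms(1,3)] by (simp add: Hom_def)

lemma submodule_preimage:
  assumes "lmodule M" "f \<in> Hom M N" "submodule T N"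
  shows "submodule {x \<in> carr M. f x \<in> T} M"
  unfolding submodule_def
  using lmoduleD[OF assms(1)] HomD[OF assms(2)] submoduleD[OF assms(3)] Hom_zero[OF assms(1,2)]
  by auto

lemma submodule_zero:
  assumes "lmodule M"
  shows "submodule {0} M"
  by (auto simp: submodule_def lmoduleD(1)[OF assms] act_zero_right[OF assms])

lemma submodule_kernel:
  assumes "lmodule M" "lmodule N" "f \<in> Hom M N"
  shows "submodule {x \<in> carr M. f x = 0} M"
  using submodule_preimage[OF assms(1,3) submodule_zero[OF assms(2)]] by simp

lemma submodule_image:
  assumes "lmodule M" "f \<in> Hom M N" "submodule T M"
  shows "submodule (f ` T) N"
  unfolding submodule_def
proof (intro conjI ballI allI)
  note T = submoduleD[OF assms(3)]
  show "f ` T \<subseteq> carr N" using T HomD(1)[OF assms(2)] by auto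
  show "0 \<in> f ` T" using T(2) Hom_zero[OF assms(1,2)] by force
  fix x assume "x \<in> f ` T"
  then obtain u where u: "u \<in> T" "x = f u" by blast
  show "act N a x \<in> f ` T" for a
    using u T(4) HomD(3)[OF assms(2) T(1)[OF u(1)], of a] by (metis image_eqI)
  show "x + y \<in> f ` T" if y: "y \<in> f ` T" for y
  proof -
    obtain v where v: "v \<in> T" "y = f v" using y by blast
    have "f (u + v) = x + y" using HomD(2)[OF assms(2) T(1)[OF u(1)] T(1)[OF v(1)]] u v by simp
    then show ?thesis using T(3)[OF u(1) v(1)] by (metis image_eqI)
  qed
qed

lemma submodule_carrier: "lmodule M \<Longrightarrow> submodule (carr M) M"
  by (simp add: submodule_def lmoduleD)


section \<open>Modules with a simple top\<close>

locale simple_top =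
  fixes P :: "('a::ring_1, 'm::ab_group_add) lmod" and L :: "('a, 'n::ab_group_add) lmod"
    and p :: "'m \<Rightarrow> 'n"
  assumes lmodule_P: "lmodule P"
    and simple_L: "simple_mod L"
    and p_Hom: "p \<in> Hom P L"
    and p_surj: "p ` carr P = carr L"
    and superfluous_ker: "superfluous {x \<in> carr P. p x = 0} P"
begin

lemma lmodule_L: "lmodule L"
  using simple_L by (simp add: simple_mod_def)

text \<open>The image of \<open>N\<close> in the simple module \<open>L\<close> is nonzero, hence
  everything, so \<open>N\<close> and the kernel of \<open>p\<close> together span \<open>P\<close>.
  Superfluity of the kernel then gives the claim.\<close>

lemma proper_submodule_ker:
  assumes N: "submodule N P" and x: "x \<in> N" "p x \<noteq> 0"
  shows "N = carr P"
proof -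
  have "submodule (p ` N) L" by (rule submodule_image[OF lmodule_P p_Hom N])
  moreover have "p ` N \<noteq> {0}" using x by auto
  ultimately have pN: "p ` N = carr L" using simple_L by (auto simp: simple_mod_def)
  have "{u + n | u n. u \<in> {x \<in> carr P. p x = 0} \<and> n \<in> N} = carr P"
  proof (intro subset_antisym subsetI)
    fix y assume y: "y \<in> carr P"
    then have "p y \<in> p ` N" using pN p_surj by auto
    then obtain n where n: "n \<in> N" "p y = p n" by auto
    have nP: "n \<in> carr P" using submoduleD(1)[OF N n(1)] .
    have "y = (y - n) + n" "y - n \<in> carr P" "p (y - n) = 0"
      using n by (auto simp: lmodule_diff lmodule_P y nP Hom_diff[OF lmodule_P p_Hom])
    then show "y \<in> {u + n | u n. u \<in> {x \<in> carr P. p x = 0} \<and> n \<in> N}" using n by blast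
  qed (auto simp: lmoduleD[OF lmodule_P] submoduleD[OF N])
  then show ?thesis using superfluous_ker N by (auto simp: superfluous_def)
qed

lemma ex_not_ker: "\<exists>x\<in>carr P. p x \<noteq> 0"
proof (rule ccontr)
  assume "\<not> ?thesis"
  then have "p ` carr P \<subseteq> {0}" by auto
  then show False using p_surj simple_L lmoduleD(1)[OF lmodule_L] by (auto simp: simple_mod_def)
qed

text \<open>The kernel of a nonzero map is a proper submodule, so it lies in the largest
  one.\<close>

lemma ker_proper:
  assumes f: "f \<in> Hom P N" "lmodule N" "f \<noteq> 0" and x: "x \<in> carr P" "f x = 0"
  shows "p x = 0"
proof (rule ccontr)
  assume "p x \<noteq> 0"
  then have "{x \<in> carr P. f x = 0} = carr P"
    using proper_submodule_ker[OF submodule_kernel[OF lmodule_P f(2,1)]] x by blast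
  then have "f y = 0" for y using HomD(4)[OF f(1)] by blast
  then show False using f(3) by (auto simp: fun_eq_iff)
qed

text \<open>A quotient of a local module is local, so the image of \<open>f\<close> in a sum of simple submodules is simple.\<close>

lemma Hom_onto_soc_ker:
  assumes M: "lmodule M" and f: "f \<in> Hom P M" "f \<noteq> 0" and img: "f ` carr P = soc M"
    and x: "x \<in> carr P" "p x = 0"
  shows "f x = 0"
proof -
  obtain y where y: "y \<in> carr P" "p y \<noteq> 0" using ex_not_ker by blast
  have "f y \<in> soc M" using y(1) img by blast
  then obtain F g where F: "finite F" "F \<subseteq> simple_submodules M" "\<And>S. S \<in> F \<Longrightarrow> g S \<in> S"
    and fy: "f y = (\<Sum>S\<in>F. g S)" unfolding soc_def by auto
  \<comment> \<open>Each single summand of \<open>f y\<close> is itself in the socle, so it can be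
    lifted along \<open>f\<close> separately.\<close>
  have "\<exists>z\<in>carr P. f z = g S" if S: "S \<in> F" for S
  proof -
    have "g S = (\<Sum>T\<in>{S}. g T)" by simp
    then have "g S \<in> soc M" unfolding soc_def using F S by blast
    then show ?thesis unfolding img[symmetric] by auto
  qed
  then obtain z where z: "\<And>S. S \<in> F \<Longrightarrow> z S \<in> carr P" "\<And>S. S \<in> F \<Longrightarrow> f (z S) = g S" by metis
  have zP: "(\<Sum>S\<in>F. z S) \<in> carr P" using lmodule_sum[OF lmodule_P] z(1) by blast
  \<comment> \<open>The lifts add up to \<open>y\<close> modulo the kernel of \<open>f\<close>,
    which lies in the kernel of \<open>p\<close>. Since \<open>p y\<close> is nonzero, some lift
    \<open>z S\<close> must survive under \<open>p\<close>.\<close>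
  have "f (y - (\<Sum>S\<in>F. z S)) = 0"
    using z fy by (simp add: Hom_diff[OF lmodule_P f(1) y(1) zP] Hom_sum[OF lmodule_P f(1)])
  then have "p (y - (\<Sum>S\<in>F. z S)) = 0"
    by (intro ker_proper[OF f(1) M f(2)] lmodule_diff lmodule_P y zP)
  then have "(\<Sum>S\<in>F. p (z S)) \<noteq> 0"
    using y(2) z(1) by (simp add: Hom_diff[OF lmodule_P p_Hom y(1) zP] Hom_sum[OF lmodule_P p_Hom])
  then obtain S where S: "S \<in> F" "p (z S) \<noteq> 0" by (meson sum.neutral)
  have subS: "submodule S M" and simpleS: "simple_mod (M\<lparr>carr := S\<rparr>)"
    using F(2) S(1) by (auto simp: simple_submodules_def)
  \<comment> \<open>The preimage of \<open>S\<close> contains \<open>z S\<close>, which lies outside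
    the kernel of \<open>p\<close>. So all of \<open>P\<close> maps into the one simple submodule
    \<open>S\<close>.\<close>
  have "{x \<in> carr P. f x \<in> S} = carr P"
    by (rule proper_submodule_ker[OF submodule_preimage[OF lmodule_P f(1) subS], of "z S"])
      (use z S F(3) in auto)
  then have fS: "f v \<in> S" if "v \<in> carr P" for v using that by blast
  define K where "K = {x \<in> carr P. p x = 0}"
  have K: "submodule K P" unfolding K_def by (rule submodule_kernel[OF lmodule_P lmodule_L p_Hom])
  have "submodule (f ` K) (M\<lparr>carr := S\<rparr>)"
    using submodule_image[OF lmodule_P f(1) K] fS by (auto simp: submodule_def K_def)
  then consider "f ` K = {0}" | "f ` K = S" using simpleS by (auto simp: simple_mod_def)
  then show ?thesis
  proof cases
    case 1
    then show ?thesis using x by (auto simp: K_def)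
  next
    case 2
    \<comment> \<open>If the kernel of \<open>p\<close> already covered \<open>S\<close>, then
      \<open>y\<close> would differ from some \<open>k\<close> in that kernel by an element killed
      by \<open>f\<close>, hence by \<open>p\<close>, against \<open>p y\<close> being
      nonzero.\<close>
    then obtain k where k: "k \<in> carr P" "p k = 0" "f y = f k" using fS[OF y(1)] by (auto simp: K_def)
    have "f (y - k) = 0" using k by (simp add: Hom_diff[OF lmodule_P f(1) y(1)])
    then have "p (y - k) = 0"
      by (intro ker_proper[OF f(1) M f(2)] lmodule_diff lmodule_P y k)
    then show ?thesis using y(2) k by (simp add: Hom_diff[OF lmodule_P p_Hom y(1)])
  qed
qed

text \<open>The contrapositive of \<open>proper_submodule_ker\<close> for the image of
  \<open>b\<close>.\<close>

lemma not_surj_ker: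
  assumes b: "b \<in> Hom Q P" and Q: "lmodule Q" and ns: "b ` carr Q \<noteq> carr P" and x: "x \<in> carr Q"
  shows "p (b x) = 0"
  using proper_submodule_ker[OF submodule_image[OF Q b submodule_carrier[OF Q]]] ns x by blast

end

text \<open>Both \<open>p \<circ> b\<close> and \<open>q\<close> map \<open>Q\<close> onto simple
  modules, and the kernel of the first lies in the kernel of the second because \<open>Q\<close> has
  a largest proper submodule. So \<open>q\<close> factors through \<open>p \<circ> b\<close>, and
  the induced map from \<open>L\<close> onto \<open>L'\<close> is bijective by Schur's
  argument.\<close>

lemma (in simple_top) surj_iso_top:
  assumes Q: "simple_top Q L' q" and b: "b \<in> Hom Q P" "b ` carr Q = carr P"
  shows "iso_mod L L'"
proof -
  interpret Q: simple_top Q L' q by (rule Q)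
  have pb: "p \<circ> b \<in> Hom Q L" by (rule Hom_comp[OF lmodule_P b(1) p_Hom])
  have "\<exists>x\<in>carr Q. p (b x) \<noteq> 0" using ex_not_ker b(2) by (metis imageE)
  then have pb0: "p \<circ> b \<noteq> 0" by (auto simp: fun_eq_iff)
  have ker: "q x = 0" if "x \<in> carr Q" "p (b x) = 0" for x
    using Q.ker_proper[OF pb lmodule_L pb0 that(1)] that(2) by simp
  \<comment> \<open>A section of \<open>p \<circ> b\<close> by choice. It need not be additive, but
    \<open>q (s u)\<close> is independent of the choice by \<open>eq\<close> below, which makes
    \<open>h\<close> a homomorphism.\<close>
  define s where "s u = (SOME x. x \<in> carr Q \<and> p (b x) = u)" for u
  have s: "s u \<in> carr Q" "p (b (s u)) = u" if u: "u \<in> carr L" for u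
  proof -
    have "\<exists>x. x \<in> carr Q \<and> p (b x) = u" using u p_surj b(2) by (metis imageE)
    then show "s u \<in> carr Q" "p (b (s u)) = u"
      unfolding s_def by (metis (mono_tags, lifting) someI_ex)+
  qed
  have eq: "q x = q y" if "x \<in> carr Q" "y \<in> carr Q" "p (b x) = p (b y)" for x y
    using ker[OF lmodule_diff[OF Q.lmodule_P that(1,2)]] that
      Hom_diff[OF Q.lmodule_P pb that(1,2)] Hom_diff[OF Q.lmodule_P Q.p_Hom that(1,2)] by simp
  define h where "h u = (if u \<in> carr L then q (s u) else 0)" for u
  have h: "h (p (b x)) = q x" if x: "x \<in> carr Q" for x
  proof -
    have u: "p (b x) \<in> carr L" using HomD(1)[OF pb x] by simp
    show ?thesis using eq[OF s(1)[OF u] x s(2)[OF u]] u by (simp add: h_def)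
  qed
  have hs: "h u = q (s u)" if "u \<in> carr L" for u using that by (simp add: h_def)
  have hHom: "h \<in> Hom L L'"
    unfolding Hom_def
  proof (intro CollectI conjI ballI allI impI)
    fix u assume u: "u \<in> carr L"
    show "h u \<in> carr L'" using s(1)[OF u] HomD(1)[OF Q.p_Hom] by (simp add: hs u)
    show "h (act L a u) = act L' a (h u)" for a
      using h[OF lmoduleD(4)[OF Q.lmodule_P s(1)[OF u]], of a] HomD(3)[OF pb s(1)[OF u], of a]
        HomD(3)[OF Q.p_Hom s(1)[OF u], of a] s(2)[OF u] by (simp add: hs u)
    show "h (u + v) = h u + h v" if v: "v \<in> carr L" for v
      using h[OF lmoduleD(2)[OF Q.lmodule_P s(1)[OF u] s(1)[OF v]]]
        HomD(2)[OF pb s(1)[OF u] s(1)[OF v]] HomD(2)[OF Q.p_Hom s(1)[OF u] s(1)[OF v]]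
        s(2)[OF u] s(2)[OF v] by (simp add: hs u v)
  qed (simp add: h_def)
  have hsurj: "h ` carr L = carr L'"
  proof (intro subset_antisym subsetI)
    fix w assume "w \<in> carr L'"
    then obtain x where "x \<in> carr Q" "q x = w" using Q.p_surj by (metis imageE)
    then show "w \<in> h ` carr L" using h HomD(1)[OF pb] by (metis comp_apply image_eqI)
  qed (use HomD(1)[OF hHom] in auto)
  have "submodule {u \<in> carr L. h u = 0} L"
    by (rule submodule_kernel[OF lmodule_L Q.lmodule_L hHom])
  moreover have "{u \<in> carr L. h u = 0} \<noteq> carr L"
  proof
    assume *: "{u \<in> carr L. h u = 0} = carr L"
    then have "h ` carr L \<subseteq> {0}" by blast
    then show False using hsurj lmoduleD(1)[OF Q.lmodule_L] Q.simple_L by (auto simp: simple_mod_def)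
  qed
  ultimately have k0: "{u \<in> carr L. h u = 0} = {0}" using simple_L by (auto simp: simple_mod_def)
  have "inj_on h (carr L)"
  proof (rule inj_onI)
    fix u v assume uv: "u \<in> carr L" "v \<in> carr L" "h u = h v"
    then have "u - v \<in> {u \<in> carr L. h u = 0}"
      by (simp add: Hom_diff[OF lmodule_L hHom] lmodule_diff lmodule_L)
    then show "u = v" unfolding k0 by simp
  qed
  then show ?thesis unfolding iso_mod_def bij_betw_def using hHom hsurj by blast
qed


section \<open>Eigenvalues on the top\<close>

text \<open>Restricted to \<open>S\<close>, the \<open>card S + 1\<close> functions
  \<open>w 0\<close>, ..., \<open>w (card S)\<close> lie in the span of \<open>card S\<close>
  indicator functions. The relation will supply the coefficients of an annihilating
  polynomial.\<close>

lemma linear_relation: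
  fixes w :: "nat \<Rightarrow> 's \<Rightarrow> 'k::field"
  assumes fin: "finite S"
  shows "\<exists>a n. (\<exists>i\<le>n. a i \<noteq> 0) \<and> (\<forall>s\<in>S. (\<Sum>i\<le>n. a i * w i s) = 0)"
proof -
  interpret F: vector_space "\<lambda>(c::'k) (f::'s \<Rightarrow> 'k) x. c * f x"
    by unfold_locales (auto simp: fun_eq_iff algebra_simps)
  have sum_app: "sum h J x = (\<Sum>j\<in>J. h j x)" for h :: "'j \<Rightarrow> 's \<Rightarrow> 'k" and J x
    by (induction J rule: infinite_finite_induct) auto
  define v where "v i = (\<lambda>s. if s \<in> S then w i s else 0)" for i
  define T where "T = (\<lambda>s x. if x = s then 1 else 0 :: 'k) ` S"
  have finT: "finite T" and cardT: "card T \<le> card S"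
    using fin by (auto simp: T_def card_image_le)
  have vT: "v i \<in> F.span T" for i
  proof -
    have "v i = (\<Sum>s\<in>S. (\<lambda>x. w i s * (if x = s then 1 else 0)))"
      using fin by (auto simp: fun_eq_iff sum_app v_def if_distrib cong: if_cong)
    also have "\<dots> \<in> F.span T"
      by (intro F.span_sum F.span_scale F.span_base) (auto simp: T_def)
    finally show ?thesis .
  qed
  let ?n = "card S"
  show ?thesis
  \<comment> \<open>Linear dependence is a property of the set of vectors and does not see
    repetitions. A coincidence \<open>v i = v j\<close> is therefore treated separately, with
    coefficients 1 and -1.\<close>
  proof (cases "inj_on v {..?n}")
    case False
    then obtain i j where ij: "i \<le> ?n" "j \<le> ?n" "i \<noteq> j" "v i = v j" by (auto simp: inj_on_def)
    have wij: "w i s = w j s" if "s \<in> S" for s using fun_cong[OF ij(4), of s] that by (simp add: v_def)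
    define a where "a l = (if l = i then 1 else 0) - (if l = j then 1 else 0 :: 'k)" for l
    have "a l * w l s = (if l = i then w l s else 0) - (if l = j then w l s else 0)" for l s
      by (simp add: a_def left_diff_distrib)
    then have "(\<Sum>l\<le>?n. a l * w l s) = w i s - w j s" for s
      using ij by (simp add: sum_subtractf)
    then have "\<forall>s\<in>S. (\<Sum>l\<le>?n. a l * w l s) = 0" using wij by simp
    moreover have "a i \<noteq> 0" using ij by (simp add: a_def)
    ultimately show ?thesis using ij(1) by blast
  next
    case True
    have "F.dependent (v ` {..?n})"
    proof (rule ccontr)
      assume "F.independent (v ` {..?n})"
      then have "card (v ` {..?n}) \<le> card T"
        using F.independent_span_bound[OF finT] vT by blast
      then show False using cardT card_image[OF True] by simp
    qed
    then obtain u where u: "\<exists>x\<in>v ` {..?n}. u x \<noteq> 0" "(\<Sum>x\<in>v ` {..?n}. (\<lambda>s. u x * x s)) = 0"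
      using F.dependent_finite[of "v ` {..?n}"] by auto
    have "(\<Sum>i\<le>?n. u (v i) * w i s) = 0" if s: "s \<in> S" for s
    proof -
      have "(\<Sum>i\<le>?n. u (v i) * w i s) = (\<Sum>x\<in>v ` {..?n}. u x * x s)"
        unfolding sum.reindex[OF True] using s by (simp add: v_def)
      also have "\<dots> = 0" using fun_cong[OF u(2), of s] by (simp add: sum_app)
      finally show ?thesis .
    qed
    then show ?thesis using u(1) by (intro exI[of _ "u \<circ> v"] exI[of _ ?n]) auto
  qed
qed

lemma scale_act_commute:
  assumes "fd_algebra scale" "lmodule M" "x \<in> carr M"
  shows "act M (scale c 1) (act M a x) = act M a (act M (scale c 1) x)"
proof -
  interpret fd_algebra scale by fact
  have "scale c 1 * a = a * scale c 1" by (simp add: scale_mult_left scale_mult_right)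
  then show ?thesis using assms(2,3) by (simp flip: lmoduleD(7))
qed

text \<open>On the top, \<open>b\<close> acts as a scalar. Take a nonzero polynomial
  \<open>q\<close> of least degree such that \<open>q(b) x0\<close> lies in the kernel of
  \<open>p\<close>; for a root \<open>c\<close> of \<open>q\<close>, the map \<open>b - c\<close> is
  not surjective, so its image lies in that kernel.\<close>

lemma (in simple_top) ex_eigenvalue:
  fixes scale :: "'k::alg_closed_field \<Rightarrow> 'a \<Rightarrow> 'a"
  assumes alg: "fd_algebra scale" and fd: "fdmodule scale L" and b: "b \<in> Hom P P"
  shows "\<exists>c. \<forall>x\<in>carr P. p (b x - act P (scale c 1) x) = 0"
proof -
  interpret fd_algebra scale by (rule alg)
  note P = lmoduleD[OF lmodule_P] and b' = HomD[OF b] and p' = HomD[OF p_Hom]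
  obtain x0 where x0: "x0 \<in> carr P" "p x0 \<noteq> 0" using ex_not_ker by blast
  define k where "k c x = act P (scale c 1) x" for c x
  have kP: "x \<in> carr P \<Longrightarrow> k c x \<in> carr P" for c x by (simp add: k_def P)
  have k_add: "x \<in> carr P \<Longrightarrow> k (c + d) x = k c x + k d x" for c d x
    by (simp add: k_def scale_left_distrib P)
  have k_add2: "x \<in> carr P \<Longrightarrow> y \<in> carr P \<Longrightarrow> k c (x + y) = k c x + k c y" for c x y
    by (simp add: k_def P)
  have k_mult: "x \<in> carr P \<Longrightarrow> k (c * d) x = k c (k d x)" for c d x
    by (simp add: k_def scale_mult_left flip: P(7))
  have k_zero: "x \<in> carr P \<Longrightarrow> k 0 x = 0" for x by (simp add: k_def act_zero_left lmodule_P)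
  have k_minus: "x \<in> carr P \<Longrightarrow> k (- c) x = - k c x" for x c
    by (simp add: k_def act_minus_left lmodule_P)
  have k_one: "x \<in> carr P \<Longrightarrow> k 1 x = x" for x by (simp add: k_def P)
  have b_k: "x \<in> carr P \<Longrightarrow> b (k c x) = k c (b x)" for c x by (simp add: k_def b')
  have b_pow: "(b ^^ i) x \<in> carr P" if "x \<in> carr P" for i x using that by (induction i) (auto simp: b')
  \<comment> \<open>\<open>E q = q(b) x0\<close>\<close>
  define E where "E = (\<lambda>q. fold_coeffs (\<lambda>a y. k a x0 + b y) q 0)"
  have b0: "b 0 = 0" using Hom_zero[OF lmodule_P b] .
  have E0: "E 0 = 0" by (simp add: E_def)
  have E_pCons: "E (pCons a q) = k a x0 + b (E q)" for a q
    by (cases "a = 0 \<and> q = 0") (auto simp: E_def k_zero x0 b0)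
  have EP: "E q \<in> carr P" for q
    by (induction q) (auto simp: E0 E_pCons P b' kP x0)
  have E_add: "E (q + r) = E q + E r" for q r
    by (induction q r rule: poly_induct2) (auto simp: E0 E_pCons k_add x0 b' EP)
  have E_sum: "E (sum g J) = (\<Sum>i\<in>J. E (g i))" for g :: "nat \<Rightarrow> 'k poly" and J
    by (induction J rule: infinite_finite_induct) (auto simp: E0 E_add)
  have E_smult: "E (smult c q) = k c (E q)" for c q
    by (induction q)
      (auto simp: E0 E_pCons k_mult x0 b_k EP k_add2 kP b' k_def[of _ 0] act_zero_right lmodule_P)
  have b_pow_k: "(b ^^ i) (k c x0) = k c ((b ^^ i) x0)" for i c
    by (induction i) (auto simp: b_k b_pow x0)
  have E_monom: "E (monom a i) = k a ((b ^^ i) x0)" for a i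
    by (induction i) (auto simp: monom_0 monom_Suc E_pCons E0 b0 k_zero x0 b_k b_pow)
  obtain S where S: "finite S" "S \<subseteq> carr L"
    "\<And>x. x \<in> carr L \<Longrightarrow> \<exists>c. x = (\<Sum>s\<in>S. act L (scale (c s) 1) s)"
    using fd by (auto simp: fdmodule_def)
  \<comment> \<open>Coordinates of the iterates in a finite spanning family of \<open>L\<close>.
    They need not be unique, so \<open>w\<close> is a choice; a relation between the coordinate
    vectors yields the polynomial \<open>q0\<close>.\<close>
  have "\<exists>c. p ((b ^^ i) x0) = (\<Sum>s\<in>S. act L (scale (c s) 1) s)" for i
    by (intro S(3) p' b_pow x0)
  then obtain w where w: "\<And>i. p ((b ^^ i) x0) = (\<Sum>s\<in>S. act L (scale (w i s) 1) s)" by metis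
  obtain a n i0 where a: "i0 \<le> n" "a i0 \<noteq> 0" "\<And>s. s \<in> S \<Longrightarrow> (\<Sum>i\<le>n. a i * w i s) = 0"
    using linear_relation[OF S(1), of w] by blast
  define q0 where "q0 = (\<Sum>i\<le>n. monom (a i) i)"
  have "coeff q0 i0 = a i0" using a(1) by (simp add: q0_def coeff_sum)
  then have q0: "q0 \<noteq> 0" using a(2) by auto
  have "p (E q0) = (\<Sum>i\<le>n. p (k (a i) ((b ^^ i) x0)))"
    by (simp add: q0_def E_sum E_monom Hom_sum[OF lmodule_P p_Hom] kP b_pow x0)
  also have "\<dots> = (\<Sum>i\<le>n. \<Sum>s\<in>S. act L (scale (a i * w i s) 1) s)"
  proof (rule sum.cong[OF refl])
    fix i
    have "p (k (a i) ((b ^^ i) x0)) = act L (scale (a i) 1) (\<Sum>s\<in>S. act L (scale (w i s) 1) s)"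
      by (simp add: k_def p' b_pow x0 w)
    also have "\<dots> = (\<Sum>s\<in>S. act L (scale (a i) 1) (act L (scale (w i s) 1) s))"
      using S(2) by (intro act_sum_right lmodule_L lmoduleD(4)) auto
    also have "\<dots> = (\<Sum>s\<in>S. act L (scale (a i * w i s) 1) s)"
      using S(2) by (intro sum.cong) (auto simp: scale_mult_left simp flip: lmoduleD(7)[OF lmodule_L])
    finally show "p (k (a i) ((b ^^ i) x0)) = (\<Sum>s\<in>S. act L (scale (a i * w i s) 1) s)" .
  qed
  also have "\<dots> = (\<Sum>s\<in>S. act L (scale (\<Sum>i\<le>n. a i * w i s) 1) s)"
    unfolding scale_sum_left using S(2)
    by (subst sum.swap) (intro sum.cong refl act_sum_left[symmetric] lmodule_L, auto)
  also have "\<dots> = 0" using S(2) by (intro sum.neutral) (auto simp: a(3) act_zero_left[OF lmodule_L])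
  finally have "q0 \<noteq> 0 \<and> p (E q0) = 0" using q0 by simp
  then obtain q where q: "q \<noteq> 0" "p (E q) = 0"
    and qmin: "\<And>r. r \<noteq> 0 \<and> p (E r) = 0 \<Longrightarrow> degree q \<le> degree r"
    using ex_has_least_nat[of "\<lambda>q. q \<noteq> 0 \<and> p (E q) = 0" q0 degree] by blast
  \<comment> \<open>A nonzero constant could be inverted, which would put \<open>x0\<close> in the
    kernel of \<open>p\<close>.\<close>
  have "degree q \<noteq> 0"
  proof
    assume "degree q = 0"
    then obtain c where c: "q = [:c:]" by (metis degree_eq_zeroE)
    then have c0: "c \<noteq> 0" using q(1) by simp
    have "p (k c x0) = 0" using q(2) by (simp add: c E_pCons E0 b0)
    then have "act L (scale (1 / c) 1) (p (k c x0)) = 0" by (simp add: act_zero_right lmodule_L)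
    then have "p (k (1 / c) (k c x0)) = 0" by (simp add: k_def p' P x0)
    then show False using x0 c0 by (simp add: k_one flip: k_mult)
  qed
  then obtain c where "poly q c = 0" using alg_closed_imp_poly_has_root[of q] by auto
  \<comment> \<open>The cofactor \<open>r\<close> has smaller degree than \<open>q\<close>, so by
    minimality \<open>p (E r)\<close> is nonzero, while \<open>b - c\<close> sends
    \<open>E r\<close> to \<open>E q\<close>, which \<open>p\<close> kills.\<close>
  then obtain r where r: "q = [:- c, 1:] * r" by (auto simp: poly_eq_0_iff_dvd dvd_def)
  have r0: "r \<noteq> 0" using q(1) r by auto
  have "degree q = Suc (degree r)" unfolding r using r0 by (subst degree_mult_eq) auto
  then have pr: "p (E r) \<noteq> 0" using qmin[of r] r0 by auto
  have Eq: "E q = b (E r) - k c (E r)"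
  proof -
    have "q = pCons 0 r + smult (- c) r" by (simp add: r)
    then show ?thesis by (simp only: E_add E_smult E_pCons) (simp add: k_zero k_minus x0 EP)
  qed
  \<comment> \<open>The endomorphism \<open>b - c\<close>, cut off to 0 outside the carrier as
    \<open>Hom\<close> requires.\<close>
  define d where "d x = (if x \<in> carr P then b x - k c x else 0)" for x
  have d: "d \<in> Hom P P"
    unfolding Hom_def
  proof (intro CollectI conjI ballI allI impI)
    fix x assume x: "x \<in> carr P"
    have act_diff: "act P a (u - v) = act P a u - act P a v" if "u \<in> carr P" "v \<in> carr P" for a u v
      using P(5)[OF lmodule_diff[OF lmodule_P that] that(2), of a] by (simp add: eq_diff_eq)
    show "d x \<in> carr P" using x by (simp add: d_def lmodule_diff lmodule_P b' kP)
    show "d (x + y) = d x + d y" if "y \<in> carr P" for y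
      using x that by (simp add: d_def P b' k_add2)
    show "d (act P a x) = act P a (d x)" for a
      using x by (simp add: d_def P b' act_diff kP) (simp add: k_def scale_act_commute[OF alg lmodule_P])
  qed (simp add: d_def)
  \<comment> \<open>If \<open>d\<close> were surjective, \<open>p \<circ> d\<close> would be a
    nonzero map killing \<open>E r\<close>, which forces \<open>p (E r) = 0\<close>.\<close>
  have "d ` carr P \<noteq> carr P"
  proof
    assume surj: "d ` carr P = carr P"
    have "p \<circ> d \<in> Hom P L" by (rule Hom_comp[OF lmodule_P d p_Hom])
    moreover have "p \<circ> d \<noteq> 0"
      using ex_not_ker surj by (metis comp_apply imageE zero_fun_apply)
    moreover have "(p \<circ> d) (E r) = 0" using q(2) Eq by (simp add: d_def EP)
    ultimately show False using ker_proper[OF _ lmodule_L _ EP] pr by blast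
  qed
  then have "p (d x) = 0" if "x \<in> carr P" for x using not_surj_ker[OF d lmodule_P] that by blast
  then show ?thesis by (intro exI[of _ c]) (auto simp: d_def k_def)
qed


section \<open>Blocks of the endomorphism algebra of a direct sum\<close>

lemma lmodule_dsum:
  assumes "\<And>l. l \<in> J \<Longrightarrow> lmodule (M l)"
  shows "lmodule (dsum J M)"
  using lmoduleD[OF assms] by (simp add: lmodule_def dsum_def fun_eq_iff)

lemma block_Hom:
  assumes M: "\<And>l. l \<in> J \<Longrightarrow> lmodule (M l)" and lm: "l \<in> J" "m \<in> J" and f: "f \<in> Hom (M l) (M m)"
  shows "block J M l m f \<in> Hom (dsum J M) (dsum J M)"
proof -
  note D = lmoduleD[OF lmodule_dsum[OF M]]
  have x: "x l \<in> carr (M l)" if "x \<in> carr (dsum J M)" for x using that lm(1) by (simp add: dsum_def)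
  have d: "(\<lambda>n. if n = m then f (x l) else 0) \<in> carr (dsum J M)" if "x \<in> carr (dsum J M)" for x
    using x[OF that] lm(2) HomD(1)[OF f] lmoduleD(1)[OF M] by (auto simp: dsum_def)
  have a: "act (dsum J M) a x l = act (M l) a (x l)" for a x using lm(1) by (simp add: dsum_def)
  have am: "act (dsum J M) a (\<lambda>n. if n = m then u else 0) = (\<lambda>n. if n = m then act (M m) a u else 0)"
    for a u using lm(2) act_zero_right[OF M] by (auto simp: dsum_def fun_eq_iff)
  show ?thesis
    unfolding Hom_def
  proof (intro CollectI conjI ballI allI impI)
    fix x assume X: "x \<in> carr (dsum J M)"
    show "block J M l m f x \<in> carr (dsum J M)" using d[OF X] X by (simp add: block_def)
    show "block J M l m f (x + y) = block J M l m f x + block J M l m f y"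
      if Y: "y \<in> carr (dsum J M)" for y
      using X Y D(2)[OF _ X Y] HomD(2)[OF f x[OF X] x[OF Y]] by (auto simp: block_def fun_eq_iff)
    show "block J M l m f (act (dsum J M) c x) = act (dsum J M) c (block J M l m f x)" for c
      using X D(4)[OF _ X, of c] HomD(3)[OF f x[OF X], of c] by (simp add: block_def a am fun_eq_iff)
  qed (simp add: block_def)
qed

text \<open>Multiplying by the idempotent of the summand \<open>m\<close> on the right leaves only
  the component of \<open>g\<close> from \<open>m\<close> to \<open>l\<close>. That component is
  \<open>b\<close>.\<close>

lemma block_comp_corner:
  fixes J :: "'l set" and M :: "'l \<Rightarrow> ('a::ring_1, 'm::ab_group_add) lmod"
  assumes M: "\<And>l. l \<in> J \<Longrightarrow> lmodule (M l)" and lm: "l \<in> J" "m \<in> J"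
    and f: "f \<in> Hom (M l) (M m)" and g: "g \<in> Hom (dsum J M) (dsum J M)"
  shows "\<exists>b\<in>Hom (M m) (M l). block J M l m f \<circ> g \<circ> block J M m m (\<lambda>y. if y \<in> carr (M m) then y else 0)
    = block J M m m (f \<circ> b)"
proof -
  let ?D = "dsum J M"
  \<comment> \<open>The inclusion of the summand \<open>m\<close>; \<open>b\<close> below is
    \<open>g\<close> after \<open>s\<close>, followed by the projection to \<open>l\<close>.\<close>
  define s :: "'m \<Rightarrow> 'l \<Rightarrow> 'm" where "s y = (\<lambda>n. if n = m then y else 0)" for y
  note D = lmoduleD[OF lmodule_dsum[OF M]]
  have sD: "s y \<in> carr ?D" if "y \<in> carr (M m)" for y
    using that lm(2) lmoduleD(1)[OF M] by (auto simp: dsum_def s_def)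
  have s_add: "s (y + z) = s y + s z" for y z by (auto simp: s_def)
  have s_act: "s (act (M m) a y) = act ?D a (s y)" for a y
    using lm(2) act_zero_right[OF M] by (auto simp: dsum_def s_def fun_eq_iff)
  have comp: "x l \<in> carr (M l)" if "x \<in> carr ?D" for x using that lm(1) by (simp add: dsum_def)
  have compm: "x m \<in> carr (M m)" if "x \<in> carr ?D" for x using that lm(2) by (simp add: dsum_def)
  have act_l: "act ?D a x l = act (M l) a (x l)" for a x using lm(1) by (simp add: dsum_def)
  define b where "b y = (if y \<in> carr (M m) then g (s y) l else 0)" for y
  have "b \<in> Hom (M m) (M l)"
    using lmoduleD[OF M[OF lm(2)]]
    by (auto simp: Hom_def b_def comp HomD[OF g] sD s_add s_act act_l)
  moreover have "block J M l m f \<circ> g \<circ> block J M m m (\<lambda>y. if y \<in> carr (M m) then y else 0)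
    = block J M m m (f \<circ> b)"
  proof
    fix x
    show "(block J M l m f \<circ> g \<circ> block J M m m (\<lambda>y. if y \<in> carr (M m) then y else 0)) x
      = block J M m m (f \<circ> b) x"
    proof (cases "x \<in> carr ?D")
      case True
      then show ?thesis
        using sD[OF compm[OF True]] compm[OF True] HomD(1)[OF g]
        by (simp add: block_def b_def flip: s_def)
    next
      case False
      \<comment> \<open>Outside the carrier the innermost block returns 0, and the outer two maps
        preserve it.\<close>
      have "g 0 = 0" by (rule Hom_zero[OF lmodule_dsum[OF M] g])
      moreover have "block J M l m f 0 = 0"
        by (rule Hom_zero[OF lmodule_dsum[OF M] block_Hom[OF M lm f]])
      moreover have "block J M m m (\<lambda>y. if y \<in> carr (M m) then y else 0) x = 0"
        "block J M m m (f \<circ> b) x = 0"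
        using False by (simp_all add: block_def)
      ultimately show ?thesis by simp
    qed
  qed
  ultimately show ?thesis by blast
qed

lemma block_zero: "block J M l m 0 = 0"
  by (auto simp: block_def fun_eq_iff)

text \<open>This is the identity of \<open>M\<close> under the convention of vanishing off the
  carrier; its blocks are the idempotents of the direct sum decomposition.\<close>

lemma idempotent_Hom: "lmodule M \<Longrightarrow> (\<lambda>y. if y \<in> carr M then y else 0) \<in> Hom M M"
  by (simp add: Hom_def lmoduleD)

lemma block_idempotent_left:
  assumes M: "\<And>l. l \<in> J \<Longrightarrow> lmodule (M l)" and lm: "l \<in> J" "m \<in> J"
    and f: "f \<in> Hom (M l) (M m)"
  shows "block J M m m (\<lambda>y. if y \<in> carr (M m) then y else 0) \<circ> block J M l m f = block J M l m f"
proof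
  fix x
  have "block J M m m (\<lambda>y. if y \<in> carr (M m) then y else 0) 0 = 0"
    by (rule Hom_zero[OF lmodule_dsum[OF M]
          block_Hom[where J=J and M=M, OF M lm(2,2) idempotent_Hom[OF M[OF lm(2)]]]])
  moreover have "f (x l) \<in> carr (M m)" if "x \<in> carr (dsum J M)"
    using that lm HomD(1)[OF f] by (simp add: dsum_def)
  moreover have "block J M l m f x \<in> carr (dsum J M)" if "x \<in> carr (dsum J M)"
    by (rule HomD(1)[OF block_Hom[OF M lm f] that])
  ultimately show "(block J M m m (\<lambda>y. if y \<in> carr (M m) then y else 0) \<circ> block J M l m f) x
      = block J M l m f x"
    by (auto simp: block_def fun_eq_iff)
qed


section \<open>Symmetrizing forms\<close>

lemma symmetrizing_formD:
  assumes "symmetrizing_form scale M \<tau>"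
  shows "f \<in> Hom M M \<Longrightarrow> \<tau> (\<lambda>x. act M (scale c 1) (f x)) = c * \<tau> f"
    and "f \<in> Hom M M \<Longrightarrow> g \<in> Hom M M \<Longrightarrow> \<tau> (f \<circ> g) = \<tau> (g \<circ> f)"
    and "f \<in> Hom M M \<Longrightarrow> f \<noteq> 0 \<Longrightarrow> \<exists>g\<in>Hom M M. \<tau> (f \<circ> g) \<noteq> 0"
  using assms unfolding symmetrizing_form_def by blast+

lemma symmetrizing_form_zero:
  assumes "lmodule M" "symmetrizing_form scale M \<tau>"
  shows "\<tau> 0 = 0"
proof -
  have "0 \<in> Hom M M" using act_zero_right[OF assms(1)] lmoduleD(1)[OF assms(1)] by (simp add: Hom_def)
  then have "\<tau> (0 + 0) = \<tau> 0 + \<tau> 0" using assms(2) unfolding symmetrizing_form_def by blast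
  then show ?thesis by (metis add_0 add_cancel_right_right)
qed

lemma symmetrizing_form_off_diagonal:
  assumes M: "\<And>l. l \<in> J \<Longrightarrow> lmodule (M l)" and tau: "symmetrizing_form scale (dsum J M) \<tau>"
    and lm: "l \<in> J" "m \<in> J" "l \<noteq> m" and f: "f \<in> Hom (M l) (M m)"
  shows "\<tau> (block J M l m f) = 0"
proof -
  let ?e = "block J M m m (\<lambda>y. if y \<in> carr (M m) then y else 0)"
  note F = block_Hom[where J=J and M=M, OF M lm(1,2) f]
    and e = block_Hom[where J=J and M=M, OF M lm(2,2) idempotent_Hom[OF M[OF lm(2)]]]
  have f0: "f 0 = 0" by (rule Hom_zero[OF M[OF lm(1)] f])
  have "block J M l m f \<circ> ?e = 0"
    using lm(3) f0 by (auto simp: block_def fun_eq_iff)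
  moreover have "\<tau> (?e \<circ> block J M l m f) = \<tau> (block J M l m f \<circ> ?e)"
    by (rule symmetrizing_formD(2)[OF tau e F])
  ultimately show ?thesis
    using block_idempotent_left[OF M lm(1,2) f] symmetrizing_form_zero[OF lmodule_dsum[OF M] tau] by simp
qed

text \<open>Non-degeneracy gives an arbitrary partner \<open>g\<close> in the whole algebra. Writing
  the block of \<open>f\<close> as \<open>e f\<close> and moving \<open>e\<close> to the right by
  symmetry replaces \<open>g\<close> by its component from \<open>m\<close> to
  \<open>l\<close>.\<close>

lemma symmetrizing_form_pairing:
  assumes M: "\<And>l. l \<in> J \<Longrightarrow> lmodule (M l)" and tau: "symmetrizing_form scale (dsum J M) \<tau>"
    and lm: "l \<in> J" "m \<in> J" and f: "f \<in> Hom (M l) (M m)" "f \<noteq> 0"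
  shows "\<exists>b\<in>Hom (M m) (M l). \<tau> (block J M m m (f \<circ> b)) \<noteq> 0"
proof -
  let ?e = "block J M m m (\<lambda>y. if y \<in> carr (M m) then y else 0)"
  let ?F = "block J M l m f"
  note F = block_Hom[where J=J and M=M, OF M lm f(1)]
    and e = block_Hom[where J=J and M=M, OF M lm(2,2) idempotent_Hom[OF M[OF lm(2)]]]
  obtain x where x: "x \<in> carr (M l)" "f x \<noteq> 0"
    using f(2) HomD(4)[OF f(1)] by (auto simp: fun_eq_iff)
  have xD: "(\<lambda>n. if n = l then x else 0) \<in> carr (dsum J M)"
    using x(1) lm(1) lmoduleD(1)[OF M] by (auto simp: dsum_def)
  have "?F (\<lambda>n. if n = l then x else 0) m = f x" using xD by (simp add: block_def)
  then have "?F \<noteq> 0" using x(2) by (metis zero_fun_apply)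
  then obtain g where g: "g \<in> Hom (dsum J M) (dsum J M)" "\<tau> (?F \<circ> g) \<noteq> 0"
    using symmetrizing_formD(3)[OF tau F] by blast
  have "\<tau> (?F \<circ> g) = \<tau> (?e \<circ> (?F \<circ> g))"
    using block_idempotent_left[OF M lm f(1)] by (simp flip: comp_assoc)
  also have "\<dots> = \<tau> (?F \<circ> g \<circ> ?e)"
    by (rule symmetrizing_formD(2)[OF tau e Hom_comp[OF lmodule_dsum[OF M] g(1) F]])
  finally show ?thesis using g(2) block_comp_corner[OF M lm f(1) g(1)] by metis
qed

theorem lemma2p12:
  fixes scale :: "'k::alg_closed_field \<Rightarrow> 'a::ring_1 \<Rightarrow> 'a"
    and \<Lambda> :: "'l set"
    and L P I :: "'l \<Rightarrow> ('a, 'm::ab_group_add) lmod"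
    and \<theta> :: "'l \<Rightarrow> 'm \<Rightarrow> 'm"
    and \<tau> :: "(('l \<Rightarrow> 'm) \<Rightarrow> ('l \<Rightarrow> 'm)) \<Rightarrow> 'k"
  defines "\<Lambda>0 \<equiv> Lambda0 scale \<Lambda> P"
    and "pr \<equiv> prime_idx \<Lambda> P I"
  assumes algebra: "fd_algebra scale"
    and finite: "finite \<Lambda>"
    and simples: "complete_simples scale \<Lambda> L"
    and proj: "\<And>l. l \<in> \<Lambda> \<Longrightarrow> projective_cover scale (P l) (L l)"
    and inj: "\<And>l. l \<in> \<Lambda> \<Longrightarrow> injective_envelope scale (I l) (L l)"
    and nonempty: "\<Lambda>0 \<noteq> {}"
    and involution: "\<And>l. l \<in> \<Lambda>0 \<Longrightarrow> pr l \<in> \<Lambda>0 \<and> pr (pr l) = l"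
    and theta: "\<And>l. l \<in> \<Lambda>0 \<Longrightarrow> \<theta> l \<in> Hom (P l) (P (pr l)) \<and> \<theta> l \<noteq> 0 \<and>
                  \<theta> l ` carr (P l) = soc (P (pr l))"
    and tau: "symmetrizing_form scale (dsum \<Lambda>0 P) \<tau>"
  shows "(\<forall>l\<in>\<Lambda>0. pr l = l \<and> \<tau> (block \<Lambda>0 P l (pr l) (\<theta> l)) \<noteq> 0) \<and>
         (\<forall>l\<in>\<Lambda>0. \<forall>m\<in>\<Lambda>0. l \<noteq> m \<longrightarrow>
            (\<forall>f\<in>Hom (P l) (P m). \<tau> (block \<Lambda>0 P l m f) = 0))"
proof (intro conjI ballI impI)
  have simple: "simple_mod (L l)" and fdL: "fdmodule scale (L l)" if "l \<in> \<Lambda>" for l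
    using simples that by (simp_all add: complete_simples_def)
  have inL: "l \<in> \<Lambda>" if "l \<in> \<Lambda>0" for l using that by (simp add: \<Lambda>0_def Lambda0_def)
  have "\<exists>p. simple_top (P l) (L l) p" if l: "l \<in> \<Lambda>" for l
    using proj[OF l] simple[OF l]
    by (auto simp: projective_cover_def projective_mod_def fdmodule_def simple_top_def)
  then obtain p where top: "\<And>l. l \<in> \<Lambda> \<Longrightarrow> simple_top (P l) (L l) (p l)" by metis
  have M: "lmodule (P l)" if "l \<in> \<Lambda>0" for l using simple_top.lmodule_P[OF top[OF inL[OF that]]] .
  show "\<tau> (block \<Lambda>0 P l m f) = 0"
    if "l \<in> \<Lambda>0" "m \<in> \<Lambda>0" "l \<noteq> m" "f \<in> Hom (P l) (P m)" for l m f
    by (rule symmetrizing_form_off_diagonal[OF M tau that])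
  fix l assume l: "l \<in> \<Lambda>0"
  have m: "pr l \<in> \<Lambda>0" using involution[OF l] by simp
  have th: "\<theta> l \<in> Hom (P l) (P (pr l))" "\<theta> l \<noteq> 0" "\<theta> l ` carr (P l) = soc (P (pr l))"
    using theta[OF l] by auto
  interpret T: simple_top "P l" "L l" "p l" by (rule top[OF inL[OF l]])
  have th_ker: "\<theta> l x = 0" if "x \<in> carr (P l)" "p l x = 0" for x
    by (rule T.Hom_onto_soc_ker[OF M[OF m] th that])
  obtain b where b: "b \<in> Hom (P (pr l)) (P l)"
    "\<tau> (block \<Lambda>0 P (pr l) (pr l) (\<theta> l \<circ> b)) \<noteq> 0"
    using symmetrizing_form_pairing[OF M tau l m th(1,2)] by blast
  \<comment> \<open>Otherwise \<open>b\<close> lands in the kernel of \<open>p l\<close>, which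
    \<theta> annihilates; the composite would vanish and could not have a nonzero trace.\<close>
  have "b ` carr (P (pr l)) = carr (P l)"
  proof (rule ccontr)
    assume ns: "b ` carr (P (pr l)) \<noteq> carr (P l)"
    have "(\<theta> l \<circ> b) x = 0" for x
    proof (cases "x \<in> carr (P (pr l))")
      case True
      then show ?thesis
        using th_ker[OF HomD(1)[OF b(1) True] T.not_surj_ker[OF b(1) M[OF m] ns True]] by simp
    next
      case False
      then show ?thesis using HomD(4)[OF b(1)] Hom_zero[OF M[OF l] th(1)] by simp
    qed
    then have "\<theta> l \<circ> b = 0" by (auto simp: fun_eq_iff)
    then show False using b(2) symmetrizing_form_zero[OF lmodule_dsum[OF M] tau] by (simp add: block_zero)
  qed
  then have "iso_mod (L l) (L (pr l))" by (rule T.surj_iso_top[OF top[OF inL[OF m]] b(1)])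
  then show eq: "pr l = l"
    using simples inL[OF l] inL[OF m] unfolding complete_simples_def by metis
  \<comment> \<open>With \<open>pr l = l\<close>, the map \<open>b\<close> is an endomorphism of
    \<open>P l\<close>, so the eigenvalue lemma applies to it.\<close>
  note th = th[unfolded eq] and b = b[unfolded eq]
  obtain c where c: "\<And>x. x \<in> carr (P l) \<Longrightarrow> p l (b x - act (P l) (scale c 1) x) = 0"
    using T.ex_eigenvalue[OF algebra fdL[OF inL[OF l]] b(1)] by blast
  have cP: "act (P l) (scale c 1) x \<in> carr (P l)" if "x \<in> carr (P l)" for x
    by (rule lmoduleD(4)[OF M[OF l] that])
  \<comment> \<open>The difference \<open>b x - c x\<close> lies in the kernel of
    \<open>p l\<close>, so \<theta> does not see it.\<close>
  have th_b: "\<theta> l (b x) = act (P l) (scale c 1) (\<theta> l x)" if x: "x \<in> carr (P l)" for x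
    using th_ker[OF lmodule_diff[OF M[OF l] HomD(1)[OF b(1) x] cP[OF x]] c[OF x]]
      Hom_diff[OF M[OF l] th(1) HomD(1)[OF b(1) x] cP[OF x]] HomD(3)[OF th(1) x, of "scale c 1"]
    by simp
  have "block \<Lambda>0 P l l (\<theta> l \<circ> b)
    = (\<lambda>x. act (dsum \<Lambda>0 P) (scale c 1) (block \<Lambda>0 P l l (\<theta> l) x))"
    using l th_b act_zero_right[OF M] by (auto simp: block_def dsum_def fun_eq_iff)
  \<comment> \<open>The left side is nonzero by the choice of \<open>b\<close>, so the factor on the
    right that carries \<theta> is nonzero too.\<close>
  then have "\<tau> (block \<Lambda>0 P l l (\<theta> l \<circ> b)) = c * \<tau> (block \<Lambda>0 P l l (\<theta> l))"
    using symmetrizing_formD(1)[OF tau block_Hom[where M=P, OF M l l th(1)]] by simp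
  then show "\<tau> (block \<Lambda>0 P l (pr l) (\<theta> l)) \<noteq> 0" using b(2) eq by auto
qed

end
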